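(* Let $\Gamma \subset \mathsf{Homeo}(M)$ be a non-elementary convergence group and let $(\sigma, \bar{\sigma}, G)$ be a coarse GPS system. Then: (1) $\sigma$ and $\bar{\sigma}$ are expanding. (2) There exists $C > 0$ such that $\|\gamma^{-1}\|_{\bar{\sigma}}-C \leq \|\gamma\|_\sigma \leq \|\gamma^{-1}\|_{\bar{\sigma}} + C$ for all $\gamma \in \Gamma$. (3) If $G$ is coarsely continuous, then there exists $C'>0$ such that $$\limsup_{\alpha \rightarrow a,\, \beta \rightarrow b}\left|G(a,b)-\left(\|\alpha^{-1}\|_\sigma+\|\beta\|_\sigma-\|\alpha^{-1}\beta\|_\sigma\right)\right| \leq C'$$ for all $(a,b)\in \Lambda(\Gamma)^{(2)}$, the limsup being over $\alpha,\beta\in\Gamma$ converging to $a,b$ in $\Gamma\sqcup M$.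
   Context: Convergence groups. $M$ is a compact metrizable space. A subgroup $\Gamma\subset\mathsf{Homeo}(M)$ is a (discrete) convergence group if for every sequence $\{\gamma_n\}$ of distinct elements of $\Gamma$ there are $x,y\in M$ and a subsequence $\{\gamma_{n_j}\}$ such that $\gamma_{n_j}|_{M\smallsetminus\{y\}}$ converges locally uniformly to the constant $x$. The limit set $\Lambda(\Gamma)$ is the set of $x\in M$ for which there are $y\in M$ and a sequence $\{\gamma_n\}\subset\Gamma$ with $\gamma_n|_{M\smallsetminus\{y\}}\to x$ locally uniformly. $\Gamma$ is non-elementary if $\#\Lambda(\Gamma)\ge 3$. An element $\gamma$ is loxodromic if it has two fixed points $\gamma^+\ne\gamma^-$ in $\Lambda(\Gamma)$ such that $\gamma^{\pm n}|_{M\smallsetminus\{\gamma^{\mp}\}}$ converges locally uniformly to $\gamma^{\pm}$ as $n\to+\infty$. For a set $A$, $A^{(2)}=\{(x,y)\in A^2:x\ne y\}$. Compatible metrics. $\Gamma\sqcup M$ carries a unique compact metrizable topology for which the inclusions of $\Gamma$ (discrete) and of $M$ are embeddings and the natural action of $\Gamma$ (left multiplication on $\Gamma$) is a convergence group action. A compatible metric $\mathrm{d}$ is a metric on $\Gamma\sqcup M$ inducing this topology; fix one. Coarse-cocycles. For $\kappa\ge0$, $\sigma\colon\Gamma\times M\to\mathbb{R}$ is a $\kappa$-coarse-cocycle if (i) $\limsup_{x\to x_0}|\sigma(\gamma,x_0)-\sigma(\gamma,x)|\le\kappa$ for all $\gamma\in\Gamma$, $x_0\in M$, and (ii) $|\sigma(\gamma_1\gamma_2,x)-(\sigma(\gamma_1,\gamma_2x)+\sigma(\gamma_2,x))|\le\kappa$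 for all $\gamma_1,\gamma_2\in\Gamma$, $x\in M$. It is proper if $\sigma(\gamma_n,\gamma_n^+)\to+\infty$ whenever $\{\gamma_n\}\subset\Gamma$ is a sequence of distinct loxodromic elements with $\liminf_n\mathrm{d}(\gamma_n^-,\gamma_n^+)>0$. It is expanding if it is proper and for each $\gamma\in\Gamma$ there is a number $\|\gamma\|_\sigma\in\mathbb{R}$ (the $\sigma$-magnitude) such that for every $\epsilon>0$ there is $C>0$ with $\|\gamma\|_\sigma-C\le\sigma(\gamma,x)\le\|\gamma\|_\sigma+C$ whenever $x\in M$, $\gamma\in\Gamma$ and $\mathrm{d}(x,\gamma^{-1})>\epsilon$ (here $\gamma^{-1}$ is a point of $\Gamma\sqcup M$). The magnitude function is any fixed choice; two choices differ by a bounded amount. GPS systems. $(\sigma,\bar\sigma,G)$ is a coarse GPS system if for some $\kappa\ge0$: $\sigma,\bar\sigma\colon\Gamma\times M\to\mathbb{R}$ are proper $\kappa$-coarse-cocycles, $G\colon M^{(2)}\to\mathbb{R}$ is locally bounded, and $|(\bar\sigma(\gamma,x)+\sigma(\gamma,y))-(G(\gamma x,\gamma y)-G(x,y))|\le\kappa$ for all $\gamma\in\Gamma$ and distinct $x,y\in M$. $G$ is coarsely continuous if there is a constant $\kappa'\ge0$ with $\limsup_{(x,y)\to(x_0,y_0)}|G(x_0,y_0)-G(x,y)|\le\kappa'$ for all $(x_0,y_0)\in M^{(2)}$. *)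

theory Defs
  imports "HOL-Analysis.Analysis"
begin

text \<open>
  The compact metrizable space \<open>M\<close> is a type \<open>'m\<close> of class metric_space whose universe is compact.
  Everything below depends only on the topology of \<open>'m\<close>, not on its metric.
  A group \<open>\<Gamma>\<close> is a set of self-maps of \<open>'m\<close>, so the group inverse is \<open>inv\<close>.
\<close>

text \<open>
  Locally uniform convergence on \<open>S\<close> to a constant \<open>x\<close>. For a constant limit, uniform convergence
  on \<open>V\<close> with respect to any metric inducing the topology of a compact metrizable \<open>X\<close> says that
  every neighbourhood of \<open>x\<close> eventually contains \<open>f n ` V\<close>.
\<close>

definition locally_unif_to_const ::
    "'a topology \<Rightarrow> 'a set \<Rightarrow> (nat \<Rightarrow> 'a \<Rightarrow> 'a) \<Rightarrow> 'a \<Rightarrow> bool" where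
  "locally_unif_to_const X S f x \<longleftrightarrow>
     (\<forall>z\<in>S. \<exists>V. openin (subtopology X S) V \<and> z \<in> V \<and>
        (\<forall>U. openin X U \<and> x \<in> U \<longrightarrow> (\<forall>\<^sub>F n in sequentially. f n ` V \<subseteq> U)))"

definition convergence_action :: "'a topology \<Rightarrow> 'g set \<Rightarrow> ('g \<Rightarrow> 'a \<Rightarrow> 'a) \<Rightarrow> bool" where
  "convergence_action X \<Gamma> act \<longleftrightarrow>
     (\<forall>\<gamma>\<in>\<Gamma>. homeomorphic_map X X (act \<gamma>)) \<and>
     (\<forall>\<gamma> :: nat \<Rightarrow> 'g. range \<gamma> \<subseteq> \<Gamma> \<and> inj \<gamma> \<longrightarrow>
        (\<exists>x\<in>topspace X. \<exists>y\<in>topspace X. \<exists>r :: nat \<Rightarrow> nat. strict_mono r \<and>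
           locally_unif_to_const X (topspace X - {y}) (\<lambda>j. act (\<gamma> (r j))) x))"

definition convergence_group :: "('m::metric_space \<Rightarrow> 'm) set \<Rightarrow> bool" where
  "convergence_group \<Gamma> \<longleftrightarrow>
     id \<in> \<Gamma> \<and> (\<forall>f\<in>\<Gamma>. \<forall>g\<in>\<Gamma>. f \<circ> g \<in> \<Gamma>) \<and> (\<forall>f\<in>\<Gamma>. inv f \<in> \<Gamma>) \<and>
     convergence_action euclidean \<Gamma> (\<lambda>\<gamma>. \<gamma>)"

definition limit_set :: "('m::metric_space \<Rightarrow> 'm) set \<Rightarrow> 'm set" where
  "limit_set \<Gamma> =
     {x. \<exists>y. \<exists>\<gamma> :: nat \<Rightarrow> 'm \<Rightarrow> 'm. range \<gamma> \<subseteq> \<Gamma> \<and> locally_unif_to_const euclidean (- {y}) \<gamma> x}"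

definition non_elementary :: "('m::metric_space \<Rightarrow> 'm) set \<Rightarrow> bool" where
  "non_elementary \<Gamma> \<longleftrightarrow> infinite (limit_set \<Gamma>) \<or> card (limit_set \<Gamma>) \<ge> 3"

text \<open>\<open>p\<close> and \<open>q\<close> are the attracting and repelling points \<open>\<gamma>\<^sup>+\<close> and \<open>\<gamma>\<^sup>-\<close>.\<close>

definition loxodromic_with ::
    "('m::metric_space \<Rightarrow> 'm) set \<Rightarrow> ('m \<Rightarrow> 'm) \<Rightarrow> 'm \<Rightarrow> 'm \<Rightarrow> bool" where
  "loxodromic_with \<Gamma> \<gamma> p q \<longleftrightarrow>
     \<gamma> \<in> \<Gamma> \<and> p \<in> limit_set \<Gamma> \<and> q \<in> limit_set \<Gamma> \<and> p \<noteq> q \<and> \<gamma> p = p \<and> \<gamma> q = q \<and>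
     locally_unif_to_const euclidean (- {q}) (\<lambda>n. \<gamma> ^^ n) p \<and>
     locally_unif_to_const euclidean (- {p}) (\<lambda>n. inv \<gamma> ^^ n) q"

definition off_diagonal :: "'a set \<Rightarrow> ('a \<times> 'a) set" where
  "off_diagonal A = {(x, y). x \<in> A \<and> y \<in> A \<and> x \<noteq> y}"

text \<open>
  The disjoint union of \<open>\<Gamma>\<close> and \<open>M\<close> is \<open>\<Gamma> <+> UNIV\<close>: group elements enter by \<open>Inl\<close>, points by \<open>Inr\<close>.
\<close>

fun union_action :: "('m \<Rightarrow> 'm) \<Rightarrow> ('m \<Rightarrow> 'm) + 'm \<Rightarrow> ('m \<Rightarrow> 'm) + 'm" where
  "union_action \<gamma> (Inl g) = Inl (\<gamma> \<circ> g)"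
| "union_action \<gamma> (Inr x) = Inr (\<gamma> x)"

definition compactifying_topology ::
    "('m::metric_space \<Rightarrow> 'm) set \<Rightarrow> (('m \<Rightarrow> 'm) + 'm) topology \<Rightarrow> bool" where
  "compactifying_topology \<Gamma> T \<longleftrightarrow>
     topspace T = \<Gamma> <+> UNIV \<and> compact_space T \<and> metrizable_space T \<and>
     embedding_map (discrete_topology \<Gamma>) T Inl \<and> embedding_map euclidean T Inr \<and>
     convergence_action T \<Gamma> union_action"

type_synonym 'm union_metric = "('m \<Rightarrow> 'm) + 'm \<Rightarrow> ('m \<Rightarrow> 'm) + 'm \<Rightarrow> real"

definition union_topology ::
    "('m::metric_space \<Rightarrow> 'm) set \<Rightarrow> 'm union_metric \<Rightarrow> (('m \<Rightarrow> 'm) + 'm) topology" where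
  "union_topology \<Gamma> d = Metric_space.mtopology (\<Gamma> <+> UNIV) d"

definition compatible_metric :: "('m::metric_space \<Rightarrow> 'm) set \<Rightarrow> 'm union_metric \<Rightarrow> bool" where
  "compatible_metric \<Gamma> d \<longleftrightarrow>
     Metric_space (\<Gamma> <+> UNIV) d \<and> compactifying_topology \<Gamma> (union_topology \<Gamma> d)"

text \<open>
  The filter of group elements \<open>\<alpha> \<in> \<Gamma>\<close> converging to the point \<open>a\<close> of \<open>M\<close> in the disjoint union.
  Neighbourhoods lie in the carrier, so membership in \<open>\<Gamma>\<close> is automatic.
\<close>

definition group_tending_to ::
    "('m::metric_space \<Rightarrow> 'm) set \<Rightarrow> 'm union_metric \<Rightarrow> 'm \<Rightarrow> ('m \<Rightarrow> 'm) filter" where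
  "group_tending_to \<Gamma> d a = filtercomap Inl (nhdsin (union_topology \<Gamma> d) (Inr a))"

text \<open>
  A function on \<open>\<Gamma> \<times> M\<close> is a total curried function; its values off \<open>\<Gamma>\<close> are irrelevant.
\<close>

definition coarse_cocycle ::
    "('m::metric_space \<Rightarrow> 'm) set \<Rightarrow> real \<Rightarrow> (('m \<Rightarrow> 'm) \<Rightarrow> 'm \<Rightarrow> real) \<Rightarrow> bool" where
  "coarse_cocycle \<Gamma> \<kappa> \<sigma> \<longleftrightarrow>
     \<kappa> \<ge> 0 \<and>
     (\<forall>\<gamma>\<in>\<Gamma>. \<forall>x0. Limsup (at x0) (\<lambda>x. ereal \<bar>\<sigma> \<gamma> x0 - \<sigma> \<gamma> x\<bar>) \<le> ereal \<kappa>) \<and>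
     (\<forall>\<gamma>1\<in>\<Gamma>. \<forall>\<gamma>2\<in>\<Gamma>. \<forall>x. \<bar>\<sigma> (\<gamma>1 \<circ> \<gamma>2) x - (\<sigma> \<gamma>1 (\<gamma>2 x) + \<sigma> \<gamma>2 x)\<bar> \<le> \<kappa>)"

definition proper_cocycle ::
    "('m::metric_space \<Rightarrow> 'm) set \<Rightarrow> 'm union_metric \<Rightarrow> (('m \<Rightarrow> 'm) \<Rightarrow> 'm \<Rightarrow> real) \<Rightarrow> bool" where
  "proper_cocycle \<Gamma> d \<sigma> \<longleftrightarrow>
     (\<forall>(\<gamma> :: nat \<Rightarrow> 'm \<Rightarrow> 'm) p q.
        inj \<gamma> \<and> (\<forall>n. loxodromic_with \<Gamma> (\<gamma> n) (p n) (q n)) \<and>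
        liminf (\<lambda>n. ereal (d (Inr (q n)) (Inr (p n)))) > 0 \<longrightarrow>
        filterlim (\<lambda>n. \<sigma> (\<gamma> n) (p n)) at_top sequentially)"

definition is_magnitude ::
    "('m::metric_space \<Rightarrow> 'm) set \<Rightarrow> 'm union_metric \<Rightarrow> (('m \<Rightarrow> 'm) \<Rightarrow> 'm \<Rightarrow> real) \<Rightarrow>
     (('m \<Rightarrow> 'm) \<Rightarrow> real) \<Rightarrow> bool" where
  "is_magnitude \<Gamma> d \<sigma> N \<longleftrightarrow>
     (\<forall>\<epsilon>>0. \<exists>C>0. \<forall>x. \<forall>\<gamma>\<in>\<Gamma>. d (Inr x) (Inl (inv \<gamma>)) > \<epsilon> \<longrightarrow>
        N \<gamma> - C \<le> \<sigma> \<gamma> x \<and> \<sigma> \<gamma> x \<le> N \<gamma> + C)"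

definition expanding ::
    "('m::metric_space \<Rightarrow> 'm) set \<Rightarrow> 'm union_metric \<Rightarrow> (('m \<Rightarrow> 'm) \<Rightarrow> 'm \<Rightarrow> real) \<Rightarrow> bool" where
  "expanding \<Gamma> d \<sigma> \<longleftrightarrow> proper_cocycle \<Gamma> d \<sigma> \<and> (\<exists>N. is_magnitude \<Gamma> d \<sigma> N)"

text \<open>Functions on the off-diagonal part of \<open>M \<times> M\<close> are total; diagonal values are never used.\<close>

definition locally_bounded_off_diagonal :: "('m::metric_space \<times> 'm \<Rightarrow> real) \<Rightarrow> bool" where
  "locally_bounded_off_diagonal G \<longleftrightarrow>
     (\<forall>z\<in>off_diagonal UNIV. \<exists>U. open U \<and> z \<in> U \<and> bounded (G ` (U \<inter> off_diagonal UNIV)))"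

definition coarse_GPS ::
    "('m::metric_space \<Rightarrow> 'm) set \<Rightarrow> 'm union_metric \<Rightarrow> (('m \<Rightarrow> 'm) \<Rightarrow> 'm \<Rightarrow> real) \<Rightarrow>
     (('m \<Rightarrow> 'm) \<Rightarrow> 'm \<Rightarrow> real) \<Rightarrow> ('m \<times> 'm \<Rightarrow> real) \<Rightarrow> bool" where
  "coarse_GPS \<Gamma> d \<sigma> \<sigma>' G \<longleftrightarrow>
     (\<exists>\<kappa>\<ge>0.
        coarse_cocycle \<Gamma> \<kappa> \<sigma> \<and> proper_cocycle \<Gamma> d \<sigma> \<and>
        coarse_cocycle \<Gamma> \<kappa> \<sigma>' \<and> proper_cocycle \<Gamma> d \<sigma>' \<and>
        locally_bounded_off_diagonal G \<and>
        (\<forall>\<gamma>\<in>\<Gamma>. \<forall>x y. x \<noteq> y \<longrightarrow>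
           \<bar>(\<sigma>' \<gamma> x + \<sigma> \<gamma> y) - (G (\<gamma> x, \<gamma> y) - G (x, y))\<bar> \<le> \<kappa>))"

definition coarsely_continuous :: "('m::metric_space \<times> 'm \<Rightarrow> real) \<Rightarrow> bool" where
  "coarsely_continuous G \<longleftrightarrow>
     (\<exists>\<kappa>'\<ge>0. \<forall>z\<in>off_diagonal UNIV.
        Limsup (at z within off_diagonal UNIV) (\<lambda>w. ereal \<bar>G z - G w\<bar>) \<le> ereal \<kappa>')"

end

theory Submission
  imports Defs
begin

text \<open>
  Every bound is obtained by compactness: a sequence in \<open>\<Gamma>\<close> has a subsequence that is constant or
  attracts the complement of a point \<open>b\<close> to a point \<open>a\<close>, and then its inverses attract the complement
  of \<open>a\<close> to \<open>b\<close>. Along such a subsequence the GPS identity, applied to suitably chosen pairs, bounds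
  (1) the oscillation of \<open>\<sigma> \<gamma>\<close> away from \<open>\<gamma>\<^sup>-\<^sup>1\<close>, which gives the magnitude, and (2) the difference
  \<open>N \<gamma> - N' (\<gamma>\<^sup>-\<^sup>1)\<close>. For (3), choose \<open>x\<close> far from \<open>\<beta>\<^sup>-\<^sup>1\<close> and \<open>z\<close> far from \<open>\<alpha>\<^sup>-\<^sup>1\<close> in a fixed pair of points. By (2)
  and the cocycle relation the combination of magnitudes is \<open>\<sigma>' \<alpha> z + \<sigma> \<alpha> (\<alpha>\<^sup>-\<^sup>1 \<beta> x)\<close> up to a bounded error,
  that is \<open>G (\<alpha> z, \<beta> x) - G (z, \<alpha>\<^sup>-\<^sup>1 \<beta> x)\<close>; the first term is close to \<open>G (a, b)\<close> and the second is
  bounded independently of \<open>a\<close> and \<open>b\<close>, because its arguments are uniformly far apart.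
\<close>

section \<open>Bounds along subsequences, and limits of functions off the diagonal\<close>

lemma uniform_bound_by_subsequences:
  fixes f :: "'a \<Rightarrow> real"
  assumes "\<And>s :: nat \<Rightarrow> 'a. (\<And>n. P (s n)) \<Longrightarrow>
    \<exists>r :: nat \<Rightarrow> nat. strict_mono r \<and> (\<exists>B. \<forall>\<^sub>F n in sequentially. \<bar>f (s (r n))\<bar> \<le> B)"
  shows "\<exists>C>0. \<forall>x. P x \<longrightarrow> \<bar>f x\<bar> \<le> C"
proof (rule ccontr)
  assume *: "\<not> ?thesis"
  \<comment> \<open>One counterexample for each level \<open>Suc n\<close>. Since
    \<open>r n \<ge> n\<close> for strictly increasing \<open>r\<close>, no subsequence of these
    counterexamples has eventually bounded values.\<close>
  have "\<exists>x. P x \<and> \<bar>f x\<bar> > real (Suc n)" for n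
    using * by (metis linorder_not_le of_nat_0_less_iff zero_less_Suc)
  then obtain s where s: "\<And>n. P (s n)" "\<And>n. \<bar>f (s n)\<bar> > real (Suc n)" by metis
  obtain r :: "nat \<Rightarrow> nat" and B where r: "strict_mono r"
    and B: "\<forall>\<^sub>F n in sequentially. \<bar>f (s (r n))\<bar> \<le> B"
    using assms[of s] s(1) by blast
  obtain m where m: "real m > B" using reals_Archimedean2 by blast
  obtain n where n: "n \<ge> m" "\<bar>f (s (r n))\<bar> \<le> B"
    using eventually_conj[OF B eventually_ge_at_top[of m]]
    by (auto simp: eventually_sequentially)
  have "real (r n) \<ge> real m" using seq_suble[OF r, of n] n(1) by linarith
  with s(2)[of "r n"] n(2) m show False by auto
qed

lemma constant_or_injective_subsequence:
  fixes s :: "nat \<Rightarrow> 'a"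
  obtains r :: "nat \<Rightarrow> nat" where "strict_mono r" "(\<exists>c. \<forall>n. s (r n) = c) \<or> inj (s \<circ> r)"
proof (cases "finite (range s)")
  case True
  then obtain c where "infinite {n. s n = s c}"
    using pigeonhole_infinite[of UNIV s] by auto
  then show ?thesis
    using that[of "enumerate {n. s n = s c}"] enumerate_in_set strict_mono_enumerate
    by (metis (mono_tags, lifting) mem_Collect_eq)
next
  case False
  \<comment> \<open>The indices at which a value occurs for the first time: \<open>s\<close> is
    injective on \<open>A\<close> and still takes all its values there, so \<open>A\<close> is
    infinite.\<close>
  define A where "A = {n. \<forall>m<n. s m \<noteq> s n}"
  have "range s \<subseteq> s ` A"
  proof
    fix y assume "y \<in> range s"
    then obtain n where n: "s n = y" "\<And>m. m < n \<Longrightarrow> s m \<noteq> y"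
      using exists_least_iff[of "\<lambda>n. s n = y"] by blast
    then have "n \<in> A" unfolding A_def by simp
    with n(1) show "y \<in> s ` A" by blast
  qed
  then have inf: "infinite A" using False finite_surj by blast
  have "inj_on s A" unfolding A_def inj_on_def by clarsimp (metis linorder_neqE_nat)
  then have "inj (s \<circ> enumerate A)"
    using enumerate_in_set[OF inf] strict_mono_imp_inj_on[OF strict_mono_enumerate[OF inf]]
    by (intro comp_inj_on) (auto intro: inj_on_subset)
  then show ?thesis using that strict_mono_enumerate[OF inf] by blast
qed

lemma eventually_neq_of_lim:
  fixes a b :: "'a::t2_space"
  assumes "(x \<longlongrightarrow> a) F" "(y \<longlongrightarrow> b) F" "a \<noteq> b"
  shows "\<forall>\<^sub>F n in F. x n \<noteq> y n"
proof -
  obtain U V where "open U" "open V" "a \<in> U" "b \<in> V" "U \<inter> V = {}"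
    using hausdorff[OF assms(3)] by blast
  then have "\<forall>\<^sub>F n in F. x n \<in> U" "\<forall>\<^sub>F n in F. y n \<in> V"
    using assms topological_tendstoD by blast+
  then show ?thesis by (rule eventually_elim2) (use \<open>U \<inter> V = {}\<close> in auto)
qed

lemma locally_bounded_off_diagonal_lim:
  assumes "locally_bounded_off_diagonal G" "x \<longlonglongrightarrow> a" "y \<longlonglongrightarrow> b" "a \<noteq> b"
  shows "\<exists>B. \<forall>\<^sub>F n in sequentially. \<bar>G (x n, y n)\<bar> \<le> B"
proof -
  have "(a, b) \<in> off_diagonal UNIV" using assms(4) by (simp add: off_diagonal_def)
  then obtain U where U: "open U" "(a, b) \<in> U" "bounded (G ` (U \<inter> off_diagonal UNIV))"
    using assms(1) unfolding locally_bounded_off_diagonal_def by blast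
  then obtain B where B: "\<And>w. w \<in> U \<inter> off_diagonal UNIV \<Longrightarrow> \<bar>G w\<bar> \<le> B"
    by (auto simp: bounded_iff)
  have "\<forall>\<^sub>F n in sequentially. (x n, y n) \<in> U"
    using tendsto_Pair[OF assms(2,3)] U topological_tendstoD by blast
  moreover have "\<forall>\<^sub>F n in sequentially. x n \<noteq> y n"
    using assms(2,3,4) by (rule eventually_neq_of_lim)
  ultimately have "\<forall>\<^sub>F n in sequentially. \<bar>G (x n, y n)\<bar> \<le> B"
    by eventually_elim (auto intro!: B simp: off_diagonal_def)
  then show ?thesis ..
qed

text \<open>Needed for the symmetry that exchanges the two cocycles of a GPS system, which swaps the
  arguments of \<open>G\<close>.\<close>

lemma locally_bounded_off_diagonal_swap:
  assumes "locally_bounded_off_diagonal G"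
  shows "locally_bounded_off_diagonal (G \<circ> prod.swap)"
  unfolding locally_bounded_off_diagonal_def
proof
  fix z :: "'a \<times> 'a" assume "z \<in> off_diagonal UNIV"
  then have "prod.swap z \<in> off_diagonal UNIV" by (auto simp: off_diagonal_def)
  then obtain U where U: "open U" "prod.swap z \<in> U" "bounded (G ` (U \<inter> off_diagonal UNIV))"
    using assms unfolding locally_bounded_off_diagonal_def by blast
  have "open (prod.swap -` U)"
    using U(1) by (rule open_vimage) (simp add: prod.swap_def continuous_intros)
  moreover have "(G \<circ> prod.swap) ` (prod.swap -` U \<inter> off_diagonal UNIV) \<subseteq> G ` (U \<inter> off_diagonal UNIV)"
    by (auto simp: off_diagonal_def)
  ultimately show "\<exists>U. open U \<and> z \<in> U \<and> bounded ((G \<circ> prod.swap) ` (U \<inter> off_diagonal UNIV))"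
    using U by (meson bounded_subset vimageI)
qed

text \<open>The extra 1 turns the weak bound on the upper limit into a strict one, which then holds
  on a whole punctured neighbourhood.\<close>

lemma coarsely_continuous_lim:
  fixes G :: "'a::metric_space \<times> 'a \<Rightarrow> real"
  assumes "\<And>z. z \<in> off_diagonal UNIV \<Longrightarrow>
      Limsup (at z within off_diagonal UNIV) (\<lambda>w. ereal \<bar>G z - G w\<bar>) \<le> ereal k"
    and "k \<ge> 0" "x \<longlonglongrightarrow> a" "y \<longlonglongrightarrow> b" "a \<noteq> b"
  shows "\<forall>\<^sub>F n in sequentially. \<bar>G (a, b) - G (x n, y n)\<bar> \<le> k + 1"
proof -
  have z: "(a, b) \<in> off_diagonal UNIV" using assms(5) by (simp add: off_diagonal_def)
  have "Limsup (at (a, b) within off_diagonal UNIV) (\<lambda>w. ereal \<bar>G (a, b) - G w\<bar>) < ereal (k + 1)"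
    using assms(1)[OF z] by (rule le_less_trans) simp
  then have "\<forall>\<^sub>F w in at (a, b) within off_diagonal UNIV. ereal \<bar>G (a, b) - G w\<bar> < ereal (k + 1)"
    by (rule Limsup_lessD)
  then obtain S where S: "open S" "(a, b) \<in> S"
     "\<And>w. w \<in> S \<Longrightarrow> w \<noteq> (a, b) \<Longrightarrow> w \<in> off_diagonal UNIV \<Longrightarrow> \<bar>G (a, b) - G w\<bar> < k + 1"
    unfolding eventually_at_topological by auto
  have "\<forall>\<^sub>F n in sequentially. (x n, y n) \<in> S"
    using tendsto_Pair[OF assms(3,4)] S(1,2) topological_tendstoD by blast
  moreover have "\<forall>\<^sub>F n in sequentially. x n \<noteq> y n"
    using assms(3,4,5) by (rule eventually_neq_of_lim)
  ultimately show ?thesis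
  proof eventually_elim
    case (elim n)
    \<comment> \<open>The filter is punctured and says nothing at \<open>(a, b)\<close> itself, but
      there the difference is 0.\<close>
    show ?case
      using S(3)[of "(x n, y n)"] elim assms(2) by (cases "(x n, y n) = (a, b)") (auto simp: off_diagonal_def)
  qed
qed

section \<open>Sequences and limits in the compactification of the group by \<open>M\<close>\<close>

locale compactified_group = Metric_space "\<Gamma> <+> UNIV" d
  for \<Gamma> :: "('m::metric_space \<Rightarrow> 'm) set" and d :: "'m union_metric" +
  assumes compact_M: "compact (UNIV :: 'm set)"
    and group: "convergence_group \<Gamma>"
    and three_points: "\<exists>u v w :: 'm. u \<noteq> v \<and> u \<noteq> w \<and> v \<noteq> w"
    and compactifying: "compactifying_topology \<Gamma> mtopology"
begin

abbreviation T where "T \<equiv> mtopology"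

lemma id_in: "id \<in> \<Gamma>" and comp_in: "f \<in> \<Gamma> \<Longrightarrow> g \<in> \<Gamma> \<Longrightarrow> f \<circ> g \<in> \<Gamma>"
  and inv_in: "f \<in> \<Gamma> \<Longrightarrow> inv f \<in> \<Gamma>"
  using group unfolding convergence_group_def by auto

lemma bij_in: assumes "g \<in> \<Gamma>" shows "bij g"
proof -
  have "homeomorphic_map euclidean euclidean g"
    using group assms unfolding convergence_group_def convergence_action_def by blast
  then show ?thesis
    unfolding homeomorphic_eq_everything_map by (simp add: bij_betw_def)
qed

lemma continuous_in: assumes "g \<in> \<Gamma>" shows "isCont g x"
proof -
  have "homeomorphic_map euclidean euclidean g"
    using group assms unfolding convergence_group_def convergence_action_def by blast
  then show ?thesis
    unfolding homeomorphic_eq_everything_map by (simp add: continuous_on_eq_continuous_at)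
qed

lemma inv_cancel [simp]: "g \<in> \<Gamma> \<Longrightarrow> inv g (g x) = x" "g \<in> \<Gamma> \<Longrightarrow> g (inv g x) = x"
  "g \<in> \<Gamma> \<Longrightarrow> inv (inv g) = g"
  using bij_in by (auto simp: bij_is_inj bij_is_surj surj_f_inv_f inv_inv_eq)

lemma union_action_inv: "g \<in> \<Gamma> \<Longrightarrow> union_action g (union_action (inv g) p) = p"
  by (cases p) (auto simp: fun_eq_iff)

lemma Inr_in [simp]: "Inr x \<in> \<Gamma> <+> UNIV" by auto

lemma union_action_in: "g \<in> \<Gamma> \<Longrightarrow> p \<in> \<Gamma> <+> UNIV \<Longrightarrow> union_action g p \<in> \<Gamma> <+> UNIV"
  by (auto simp: comp_in)

lemma point_neq: obtains x :: 'm where "x \<noteq> a" "x \<noteq> b"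
  using three_points by metis

lemma limitin_Inr [simp]: "limitin T (\<lambda>n. Inr (f n)) (Inr x) sequentially \<longleftrightarrow> f \<longlonglongrightarrow> x"
proof -
  have "embedding_map euclidean T (Inr :: 'm \<Rightarrow> _)"
    using compactifying unfolding compactifying_topology_def by blast
  then obtain g where g: "homeomorphic_maps euclidean (subtopology T (range Inr)) (Inr :: 'm \<Rightarrow> _) g"
    unfolding embedding_map_def homeomorphic_map_maps by auto
  then have c: "continuous_map euclidean (subtopology T (range Inr)) (Inr :: 'm \<Rightarrow> _)"
      "continuous_map (subtopology T (range Inr)) euclidean g" "\<And>x. g (Inr x) = x"
    unfolding homeomorphic_maps_def by auto
  show ?thesis
  proof
    assume "limitin T (\<lambda>n. Inr (f n)) (Inr x) sequentially"
    then have "limitin (subtopology T (range Inr)) (\<lambda>n. Inr (f n)) (Inr x) sequentially"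
      by (simp add: limitin_subtopology)
    from continuous_map_limit[OF c(2) this] show "f \<longlonglongrightarrow> x"
      by (simp add: c(3) o_def)
  next
    assume "f \<longlonglongrightarrow> x"
    then have "limitin euclidean f x sequentially" by simp
    from continuous_map_limit[OF c(1) this] 
    show "limitin T (\<lambda>n. Inr (f n)) (Inr x) sequentially"
      by (simp add: limitin_subtopology o_def)
  qed
qed

lemma convergent_subsequence:
  assumes "\<And>n. p n \<in> \<Gamma> <+> UNIV"
  obtains r :: "nat \<Rightarrow> nat" and q where "strict_mono r" "limitin T (p \<circ> r) q sequentially"
proof -
  have "compact_space T" using compactifying unfolding compactifying_topology_def by blast
  then show ?thesis
    using assms that unfolding compact_space_sequentially by (meson image_subset_iff)
qed

lemma convergent_subsequence_M:
  obtains r :: "nat \<Rightarrow> nat" and x :: 'm where "strict_mono r" "(p \<circ> r) \<longlonglongrightarrow> x"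
  using compact_imp_seq_compact[OF compact_M] unfolding seq_compact_def by blast

lemma limitin_subseq: 
  assumes "strict_mono (r :: nat \<Rightarrow> nat)" "limitin T p q sequentially"
  shows "limitin T (\<lambda>n. p (r n)) q sequentially"
  using limitin_subsequence[OF assms] by (simp add: o_def)

text \<open>Compactness of \<open>M\<close> provides a subsequence with a limit in \<open>M\<close>,
  and limits in a metric space are unique.\<close>

lemma limit_in_M:
  assumes "limitin T (\<lambda>n. Inr (f n)) q sequentially"
  obtains x where "q = Inr x" 
proof -
  obtain r x where r: "strict_mono r" "(f \<circ> r) \<longlonglongrightarrow> x" by (rule convergent_subsequence_M)
  have "limitin T (\<lambda>n. Inr ((f \<circ> r) n)) (Inr x) sequentially" using r(2) by (simp only: limitin_Inr)
  with limitin_subseq[OF r(1) assms] have "q = Inr x"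
    using limitin_metric_unique trivial_limit_sequentially unfolding o_def by blast
  then show ?thesis by (rule that)
qed

text \<open>If convergence failed, infinitely many terms would avoid a neighbourhood of
  \<open>q\<close>. By compactness some of them would form a convergent subsequence; its limit would
  be \<open>q\<close>, which is impossible outside that neighbourhood.\<close>

lemma limitin_by_subsequences:
  assumes "\<And>n. p n \<in> \<Gamma> <+> UNIV" "q \<in> \<Gamma> <+> UNIV"
    and "\<And>r c. strict_mono r \<Longrightarrow> limitin T (\<lambda>n. p (r n)) c sequentially \<Longrightarrow> c = q"
  shows "limitin T p q sequentially"
proof (rule ccontr)
  assume "\<not> ?thesis"
  then obtain U where U: "openin T U" "q \<in> U" "\<not> (\<forall>\<^sub>F n in sequentially. p n \<in> U)"
    using assms(2) unfolding limitin_def by auto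
  then have "infinite {n. p n \<notin> U}"
    by (simp add: not_eventually frequently_cofinite flip: cofinite_eq_sequentially)
  then have r: "strict_mono (enumerate {n. p n \<notin> U})" "\<And>n. p (enumerate {n. p n \<notin> U} n) \<notin> U"
    using strict_mono_enumerate enumerate_in_set by blast+
  obtain s c where s: "strict_mono s" 
      "limitin T ((\<lambda>n. p (enumerate {n. p n \<notin> U} n)) \<circ> s) c sequentially"
    using convergent_subsequence[of "\<lambda>n. p (enumerate {n. p n \<notin> U} n)"] assms(1) by blast
  then have "c = q" using assms(3)[of "enumerate {n. p n \<notin> U} \<circ> s"] r(1)
    by (simp add: o_def strict_mono_o[unfolded o_def])
  then have "\<forall>\<^sub>F n in sequentially. p (enumerate {n. p n \<notin> U} (s n)) \<in> U"
    using s(2) U unfolding limitin_def by auto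
  then show False using r(2) by (simp add: eventually_sequentially)
qed

section \<open>Attracting and repelling points of sequences of group elements\<close>

lemma locally_unif_lim:
  assumes "locally_unif_to_const T (topspace T - {y}) f x" "x \<in> \<Gamma> <+> UNIV"
    and "limitin T p q sequentially" "q \<noteq> y"
  shows "limitin T (\<lambda>n. f n (p n)) x sequentially"
proof -
  have q: "q \<in> topspace T - {y}" using limitin_topspace[OF assms(3)] assms(4) by simp
  then obtain V where V: "openin (subtopology T (topspace T - {y})) V" "q \<in> V"
    "\<And>U. openin T U \<and> x \<in> U \<Longrightarrow> (\<forall>\<^sub>F n in sequentially. f n ` V \<subseteq> U)"
    using assms(1) unfolding locally_unif_to_const_def by (elim ballE[of _ _ q]) blast+
  \<comment> \<open>\<open>V\<close> is open only relative to the complement of \<open>y\<close>.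
    Points are closed, so \<open>V\<close> is open in \<open>T\<close> and eventually contains the
    moving points \<open>p n\<close>.\<close>
  have "t1_space T" using Hausdorff_imp_t1_space[OF Hausdorff_space_mtopology] .
  then have "openin T (topspace T - {y})"
    by (simp add: t1_space_openin_delete_alt)
  then have "openin T V" using openin_trans_full[OF V(1)] by simp
  then have ev: "\<forall>\<^sub>F n in sequentially. p n \<in> V" using assms(3) V(2) unfolding limitin_def by blast
  show ?thesis unfolding limitin_def
  proof (intro conjI allI impI)
    show "x \<in> topspace T" using assms(2) by simp
    fix U assume "openin T U \<and> x \<in> U"
    from V(3)[OF this] ev show "\<forall>\<^sub>F n in sequentially. f n (p n) \<in> U"
      by eventually_elim blast
  qed
qed

text \<open>The convergence is required on the whole compactification rather than on
  \<open>M\<close> alone, so that it applies to points of the group as well.\<close>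

definition attracts :: "(nat \<Rightarrow> 'm \<Rightarrow> 'm) \<Rightarrow> 'm \<Rightarrow> 'm \<Rightarrow> bool" where
  "attracts \<gamma> a b \<longleftrightarrow> range \<gamma> \<subseteq> \<Gamma> \<and>
     locally_unif_to_const T (topspace T - {Inr b}) (\<lambda>n. union_action (\<gamma> n)) (Inr a)"

lemma locally_unif_to_const_subseq:
  assumes "locally_unif_to_const X S f x" "strict_mono (r :: nat \<Rightarrow> nat)"
  shows "locally_unif_to_const X S (\<lambda>n. f (r n)) x"
  using assms eventually_subseq[OF assms(2)] unfolding locally_unif_to_const_def
  by meson

lemma attracts_subseq:
  assumes "attracts \<gamma> a b" "strict_mono (r :: nat \<Rightarrow> nat)"
  shows "attracts (\<lambda>n. \<gamma> (r n)) a b"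
  using assms locally_unif_to_const_subseq[OF _ assms(2)] unfolding attracts_def
  by fast

lemma attracts_lim:
  assumes "attracts \<gamma> a b" "limitin T p q sequentially" "q \<noteq> Inr b"
  shows "limitin T (\<lambda>n. union_action (\<gamma> n) (p n)) (Inr a) sequentially"
  using assms(1) locally_unif_lim[OF _ Inr_in assms(2,3)] unfolding attracts_def by blast

text \<open>If a subsequence of the preimages had a limit other than \<open>b\<close>, then
  \<open>\<gamma> n\<close> would carry it to \<open>a\<close>. But it carries the preimages back to
  \<open>p n\<close>, whose limit \<open>q\<close> is not \<open>a\<close>.\<close>

lemma attracts_inv_lim:
  assumes "attracts \<gamma> a b" "limitin T p q sequentially" "q \<noteq> Inr a" "\<And>n. p n \<in> \<Gamma> <+> UNIV"
  shows "limitin T (\<lambda>n. union_action (inv (\<gamma> n)) (p n)) (Inr b) sequentially"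
proof (rule limitin_by_subsequences)
  have \<gamma>: "\<gamma> n \<in> \<Gamma>" for n using assms(1) unfolding attracts_def by auto
  show "union_action (inv (\<gamma> n)) (p n) \<in> \<Gamma> <+> UNIV" for n
    using \<gamma> inv_in union_action_in assms(4) by blast
  fix r c assume r: "strict_mono (r :: nat \<Rightarrow> nat)"
    "limitin T (\<lambda>n. union_action (inv (\<gamma> (r n))) (p (r n))) c sequentially"
  show "c = Inr b"
  proof (rule ccontr)
    assume "c \<noteq> Inr b"
    from attracts_lim[OF attracts_subseq[OF assms(1) r(1)] r(2) this]
    have "limitin T (\<lambda>n. p (r n)) (Inr a) sequentially"
      by (simp add: union_action_inv \<gamma>)
    with limitin_subseq[OF r(1) assms(2)] assms(3) show False
      using limitin_metric_unique by force
  qed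
qed (rule Inr_in)

lemma limitin_id: "limitin T (\<lambda>n. Inl id) (Inl id) sequentially"
  by (rule limitin_eventually) (use id_in in auto)

text \<open>The elements and their inverses are the images of the identity, a point of the
  compactification that lies outside \<open>M\<close> and so is neither \<open>a\<close> nor
  \<open>b\<close>.\<close>

lemma attracts_self:
  assumes "attracts \<gamma> a b"
  shows "limitin T (\<lambda>n. Inl (\<gamma> n)) (Inr a) sequentially"
    and "limitin T (\<lambda>n. Inl (inv (\<gamma> n))) (Inr b) sequentially"
proof -
  show "limitin T (\<lambda>n. Inl (\<gamma> n)) (Inr a) sequentially"
    using attracts_lim[OF assms limitin_id] by simp
  show "limitin T (\<lambda>n. Inl (inv (\<gamma> n))) (Inr b) sequentially"
    using attracts_inv_lim[OF assms limitin_id _ InlI[OF id_in]] by simp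
qed

lemma attracts_lim_M:
  assumes "attracts \<gamma> a b" "p \<longlonglongrightarrow> q" "q \<noteq> b"
  shows "(\<lambda>n. \<gamma> n (p n)) \<longlonglongrightarrow> a"
  using attracts_lim[of \<gamma> a b "\<lambda>n. Inr (p n)" "Inr q"] assms by simp

lemma attracts_inv_lim_M:
  assumes "attracts \<gamma> a b" "p \<longlonglongrightarrow> q" "q \<noteq> a"
  shows "(\<lambda>n. inv (\<gamma> n) (p n)) \<longlonglongrightarrow> b"
  using attracts_inv_lim[of \<gamma> a b "\<lambda>n. Inr (p n)" "Inr q"] assms by simp

text \<open>The convergence property in \<open>T\<close> gives points \<open>x\<close> and
  \<open>y\<close> of the union; what remains is to place both of them in \<open>M\<close>. The
  first is a limit of points of \<open>M\<close>.\<close>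

lemma injective_attracts:
  fixes \<gamma> :: "nat \<Rightarrow> 'm \<Rightarrow> 'm"
  assumes "\<And>n. \<gamma> n \<in> \<Gamma>" "inj \<gamma>"
  obtains r a b where "strict_mono r" "attracts (\<lambda>n. \<gamma> (r n)) a b"
proof -
  have "convergence_action T \<Gamma> union_action"
    using compactifying unfolding compactifying_topology_def by blast
  then obtain x y and r :: "nat \<Rightarrow> nat" where r: "strict_mono r"
    and x: "x \<in> \<Gamma> <+> UNIV" and y: "y \<in> \<Gamma> <+> UNIV"
    and lu: "locally_unif_to_const T (topspace T - {y}) (\<lambda>j. union_action (\<gamma> (r j))) x"
    using assms unfolding convergence_action_def topspace_mtopology by (metis image_subset_iff)
  obtain z :: 'm where "Inr z \<noteq> y" using point_neq by (metis Inr_inject)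
  from locally_unif_lim[OF lu x, of "\<lambda>n. Inr z" "Inr z"] this
  have "limitin T (\<lambda>n. Inr (\<gamma> (r n) z)) x sequentially"
    by simp
  then obtain a where a: "x = Inr a" by (rule limit_in_M)
  have "y \<in> range Inr"
  proof (rule ccontr)
    assume y: "y \<notin> range Inr"
    \<comment> \<open>If \<open>y\<close> were a group element, all of \<open>M\<close> would be
      attracted to \<open>a\<close>, even along a convergent subsequence of the preimages of
      \<open>w\<close>. The images of these preimages are constantly \<open>w\<close>.\<close>
    obtain w where w: "w \<noteq> a" using point_neq by metis
    obtain s q where s: "strict_mono s" "((\<lambda>n. inv (\<gamma> (r n)) w) \<circ> s) \<longlonglongrightarrow> q"
      by (rule convergent_subsequence_M)
    have "locally_unif_to_const T (topspace T - {y}) (\<lambda>j. union_action (\<gamma> (r (s j)))) x"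
      by (rule locally_unif_to_const_subseq[OF lu s(1)])
    from locally_unif_lim[OF this x, of "\<lambda>n. Inr (inv (\<gamma> (r (s n))) w)" "Inr q"] s(2) y
    have "limitin T (\<lambda>n. Inr w) (Inr a) sequentially"
      by (auto simp: o_def assms a)
    then show False using w by (simp add: tendsto_const_iff)
  qed
  then obtain b where "y = Inr b" by blast
  then have "attracts (\<lambda>n. \<gamma> (r n)) a b" using lu a assms unfolding attracts_def by auto
  then show ?thesis using r that by blast
qed

text \<open>A constant subsequence would have its limit in the group, so an injective one exists.
  Its attracting point is the limit of the elements themselves, hence \<open>a\<close>.\<close>

lemma tending_attracts:
  assumes "\<And>n. \<gamma> n \<in> \<Gamma>" "limitin T (\<lambda>n. Inl (\<gamma> n)) (Inr a) sequentially"
  obtains r b where "strict_mono r" "attracts (\<lambda>n. \<gamma> (r n)) a b"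
proof -
  obtain r :: "nat \<Rightarrow> nat" where r: "strict_mono r" "(\<exists>c. \<forall>n. \<gamma> (r n) = c) \<or> inj (\<gamma> \<circ> r)"
    by (rule constant_or_injective_subsequence)
  note lim = limitin_subseq[OF r(1) assms(2)]
  have "\<not> (\<exists>c. \<forall>n. \<gamma> (r n) = c)"
  proof
    assume "\<exists>c. \<forall>n. \<gamma> (r n) = c"
    then obtain c where c: "\<And>n. \<gamma> (r n) = c" by blast
    then have "c \<in> \<Gamma>" using assms(1) by metis
    then have "limitin T (\<lambda>n. Inl c) (Inl c) sequentially" by (simp add: InlI)
    then show False using lim limitin_metric_unique by (fastforce simp: c)
  qed
  then have "inj (\<lambda>n. \<gamma> (r n))" using r(2) by (auto simp: o_def)
  then obtain s a' b where s: "strict_mono s" "attracts (\<lambda>n. \<gamma> (r (s n))) a' b"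
    using injective_attracts[of "\<lambda>n. \<gamma> (r n)"] assms(1) by metis
  have "a' = a"
    using attracts_self(1)[OF s(2)] limitin_subseq[OF s(1) lim] limitin_metric_unique by force
  then show ?thesis using that[of "r \<circ> s"] s r strict_mono_o by (auto simp: o_def)
qed

section \<open>Distances to group elements, and the filter of elements tending to a point\<close>

lemma far_lim:
  assumes "limitin T p (Inr b) sequentially" "x \<longlonglongrightarrow> c"
    and "\<And>n. d (Inr (x n)) (p n) > \<epsilon>" "\<epsilon> > 0"
  shows "c \<noteq> b"
proof
  assume "c = b"
  \<comment> \<open>Both \<open>x n\<close> and \<open>p n\<close> would come within half of
    \<open>\<epsilon>\<close> of \<open>b\<close>, against the assumed distance between
    them.\<close>
  then have "limitin T (\<lambda>n. Inr (x n)) (Inr b) sequentially" using assms(2) by simp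
  then have "\<forall>\<^sub>F n in sequentially. Inr (x n) \<in> \<Gamma> <+> UNIV \<and> d (Inr (x n)) (Inr b) < \<epsilon> / 2"
    using assms(4) unfolding limitin_metric by (meson half_gt_zero)
  moreover have "\<forall>\<^sub>F n in sequentially. p n \<in> \<Gamma> <+> UNIV \<and> d (p n) (Inr b) < \<epsilon> / 2"
    using assms(1,4) unfolding limitin_metric by (meson half_gt_zero)
  ultimately have "\<forall>\<^sub>F n in sequentially. False"
  proof eventually_elim
    case (elim n)
    then have "d (Inr (x n)) (p n) \<le> d (Inr (x n)) (Inr b) + d (p n) (Inr b)"
      using triangle'[of "Inr (x n)" "Inr b" "p n"] commute by simp
    then show False using elim assms(3)[of n] by linarith
  qed
  then show False by simp
qed

lemma eventually_far:
  assumes "limitin T p q sequentially" "d (Inr x) q > \<epsilon>"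
  shows "\<forall>\<^sub>F n in sequentially. d (Inr x) (p n) > \<epsilon>"
proof -
  have "\<forall>\<^sub>F n in sequentially. p n \<in> \<Gamma> <+> UNIV \<and> d (p n) q < d (Inr x) q - \<epsilon>"
    using assms unfolding limitin_metric by (simp add: diff_gt_0_iff_gt)
  moreover have "q \<in> \<Gamma> <+> UNIV" using assms(1) limitin_metric by blast
  ultimately show ?thesis
  proof (elim eventually_mono)
    fix n assume "p n \<in> \<Gamma> <+> UNIV \<and> d (p n) q < d (Inr x) q - \<epsilon>"
    then show "d (Inr x) (p n) > \<epsilon>"
      using triangle[of "Inr x" "p n" q] \<open>q \<in> \<Gamma> <+> UNIV\<close> by simp
  qed
qed

lemma d_pos: "x \<noteq> y \<Longrightarrow> d (Inr x) (Inr y) > 0"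
  using mdist_pos_less by simp

text \<open>Two fixed points serve as evaluation points for the entire group: each element of the
  compactification is far from at least one of them, with a uniform threshold.\<close>

lemma far_pair:
  shows "\<exists>u v. \<exists>\<epsilon>>0. \<forall>p\<in>\<Gamma> <+> UNIV. d (Inr u) p > \<epsilon> \<or> d (Inr v) p > \<epsilon>"
proof -
  obtain u v :: 'm where "u \<noteq> v" using three_points by blast
  then have pos: "d (Inr u) (Inr v) > 0" by (rule d_pos)
  \<comment> \<open>One of the two distances is at least half of the distance from \<open>u\<close>
    to \<open>v\<close>; a quarter leaves room for the strict inequality.\<close>
  have "d (Inr u) p > d (Inr u) (Inr v) / 4 \<or> d (Inr v) p > d (Inr u) (Inr v) / 4" if "p \<in> \<Gamma> <+> UNIV" for p
  proof -
    have "d (Inr u) (Inr v) \<le> d (Inr u) p + d (Inr v) p"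
      using triangle[of "Inr u" p "Inr v"] commute[of p "Inr v"] that by simp
    then show ?thesis using pos by linarith
  qed
  then show ?thesis
    using pos by (intro exI[of _ u] exI[of _ v] exI[of _ "d (Inr u) (Inr v) / 4"]) auto
qed

lemma eventually_group_tending_to:
  assumes "\<delta> > 0"
  shows "\<forall>\<^sub>F g in group_tending_to \<Gamma> d a. g \<in> \<Gamma> \<and> d (Inl g) (Inr a) < \<delta>"
proof -
  have "\<forall>\<^sub>F p in nhdsin T (Inr a). p \<in> mball (Inr a) \<delta>"
    using assms by (auto simp: eventually_nhdsin intro!: exI[of _ "mball (Inr a) \<delta>"])
  then have "\<forall>\<^sub>F g in group_tending_to \<Gamma> d a. Inl g \<in> mball (Inr a) \<delta>"
    unfolding group_tending_to_def union_topology_def by (rule eventually_filtercomapI)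
  then show ?thesis by eventually_elim (auto simp: commute)
qed

text \<open>If the property failed on the product filter, balls of radius \<open>1 / (n + 1)\<close>
  would supply two convergent sequences violating it at every index. A single good index on each
  such pair of sequences is therefore enough.\<close>

lemma eventually_pair_tending_to:
  assumes "\<And>f h. (\<And>n. f n \<in> \<Gamma>) \<Longrightarrow> (\<And>n. h n \<in> \<Gamma>) \<Longrightarrow>
    limitin T (\<lambda>n. Inl (f n)) (Inr a) sequentially \<Longrightarrow>
    limitin T (\<lambda>n. Inl (h n)) (Inr b) sequentially \<Longrightarrow> \<exists>n. P (f n) (h n)"
  shows "\<forall>\<^sub>F (f, h) in group_tending_to \<Gamma> d a \<times>\<^sub>F group_tending_to \<Gamma> d b. P f h"
proof (rule ccontr)
  assume not: "\<not> ?thesis"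
  have "\<exists>f h. f \<in> \<Gamma> \<and> h \<in> \<Gamma> \<and> d (Inl f) (Inr a) < inverse (real (Suc n)) \<and>
      d (Inl h) (Inr b) < inverse (real (Suc n)) \<and> \<not> P f h" for n
  proof (rule ccontr)
    assume *: "\<not> ?thesis"
    have pos: "inverse (real (Suc n)) > 0" by simp
    have "\<forall>\<^sub>F (f, h) in group_tending_to \<Gamma> d a \<times>\<^sub>F group_tending_to \<Gamma> d b. P f h"
      unfolding eventually_prod_filter
      using eventually_group_tending_to[OF pos, of a] eventually_group_tending_to[OF pos, of b] *
      by fastforce
    with not show False ..
  qed
  then obtain f h where fh: "\<And>n. f n \<in> \<Gamma>" "\<And>n. h n \<in> \<Gamma>"
    "\<And>n. d (Inl (f n)) (Inr a) < inverse (real (Suc n))"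
    "\<And>n. d (Inl (h n)) (Inr b) < inverse (real (Suc n))" "\<And>n. \<not> P (f n) (h n)" by metis
  have lim: "limitin T (\<lambda>n. Inl (g n)) (Inr c) sequentially"
    if "\<And>n. g n \<in> \<Gamma>" "\<And>n. d (Inl (g n)) (Inr c) < inverse (real (Suc n))" for g c
  proof -
    have "(\<lambda>n. d (Inl (g n)) (Inr c)) \<longlonglongrightarrow> 0"
      using that(2) by (intro tendsto_sandwich[OF _ _ tendsto_const LIMSEQ_inverse_real_of_nat])
        (auto intro!: always_eventually less_imp_le)
    then show ?thesis using that(1) by (auto simp: limitin_metric_dist_null InlI)
  qed
  show False using assms[OF fh(1,2) lim[OF fh(1,3)] lim[OF fh(2,4)]] fh(5) by blast
qed

end

section \<open>Coarse GPS systems and the existence of magnitudes\<close>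

locale coarse_GPS_system = compactified_group \<Gamma> d
  for \<Gamma> :: "('m::metric_space \<Rightarrow> 'm) set" and d :: "'m union_metric" +
  fixes \<sigma> \<sigma>' :: "('m \<Rightarrow> 'm) \<Rightarrow> 'm \<Rightarrow> real" and G :: "'m \<times> 'm \<Rightarrow> real" and \<kappa> :: real
  assumes cocycle: "\<And>f g x. f \<in> \<Gamma> \<Longrightarrow> g \<in> \<Gamma> \<Longrightarrow> \<bar>\<sigma> (f \<circ> g) x - (\<sigma> f (g x) + \<sigma> g x)\<bar> \<le> \<kappa>"
    and cocycle': "\<And>f g x. f \<in> \<Gamma> \<Longrightarrow> g \<in> \<Gamma> \<Longrightarrow> \<bar>\<sigma>' (f \<circ> g) x - (\<sigma>' f (g x) + \<sigma>' g x)\<bar> \<le> \<kappa>"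
    and locally_bounded: "locally_bounded_off_diagonal G"
    and GPS: "\<And>g x y. g \<in> \<Gamma> \<Longrightarrow> x \<noteq> y \<Longrightarrow>
      \<bar>(\<sigma>' g x + \<sigma> g y) - (G (g x, g y) - G (x, y))\<bar> \<le> \<kappa>"
begin

text \<open>By this symmetry every result about \<open>\<sigma>\<close> also holds for
  \<open>\<sigma>'\<close>.\<close>

lemma conjugate: "coarse_GPS_system \<Gamma> d \<sigma>' \<sigma> (G \<circ> prod.swap) \<kappa>"
proof unfold_locales
  show "locally_bounded_off_diagonal (G \<circ> prod.swap)"
    using locally_bounded by (rule locally_bounded_off_diagonal_swap)
  show "\<bar>(\<sigma> g x + \<sigma>' g y) - ((G \<circ> prod.swap) (g x, g y) - (G \<circ> prod.swap) (x, y))\<bar> \<le> \<kappa>"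
    if "g \<in> \<Gamma>" "x \<noteq> y" for g x y
    using GPS[of g y x] that by (simp add: add.commute)
qed (use cocycle cocycle' in blast)+

text \<open>One \<open>\<kappa>\<close> comes from the relation for \<open>inv g \<circ> g\<close>;
  the other bounds the value at the identity, by the relation for
  \<open>id \<circ> id\<close>.\<close>

lemma cocycle_inv:
  assumes "g \<in> \<Gamma>"
  shows "\<bar>\<sigma> (inv g) (g x) + \<sigma> g x\<bar> \<le> 2 * \<kappa>"
proof -
  have "inv g \<circ> g = id" using assms by (auto simp: fun_eq_iff)
  then show ?thesis
    using cocycle[OF inv_in[OF assms] assms, of x] cocycle[OF id_in id_in, of x] by simp
qed

text \<open>
  Subtracting the GPS identity at \<open>(z, y)\<close> from the one at \<open>(z, x)\<close> expresses
  \<open>\<sigma> \<gamma> x - \<sigma> \<gamma> y\<close> through values of \<open>G\<close>. With \<open>z = \<gamma>\<^sup>-\<^sup>1 w\<close>, where \<open>w\<close> is not the attracting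
  point, all four arguments of \<open>G\<close> stay away from the diagonal.
\<close>

lemma GPS_difference:
  assumes "g \<in> \<Gamma>" "z \<noteq> x" "z \<noteq> y" "\<bar>G (g z, g x)\<bar> \<le> B1" "\<bar>G (g z, g y)\<bar> \<le> B2"
    "\<bar>G (z, x)\<bar> \<le> B3" "\<bar>G (z, y)\<bar> \<le> B4"
  shows "\<bar>\<sigma> g x - \<sigma> g y\<bar> \<le> B1 + B2 + B3 + B4 + 2 * \<kappa>"
  using GPS[OF assms(1,2)] GPS[OF assms(1,3)] assms(4-7) by linarith

lemma GPS_difference_lim:
  assumes g: "\<And>n. g n \<in> \<Gamma>"
    and lim: "z \<longlonglongrightarrow> z0" "x \<longlonglongrightarrow> x0" "y \<longlonglongrightarrow> y0" "z0 \<noteq> x0" "z0 \<noteq> y0"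
    and glim: "(\<lambda>n. g n (z n)) \<longlonglongrightarrow> z1" "(\<lambda>n. g n (x n)) \<longlonglongrightarrow> x1" "(\<lambda>n. g n (y n)) \<longlonglongrightarrow> y1"
      "z1 \<noteq> x1" "z1 \<noteq> y1"
  shows "\<exists>B. \<forall>\<^sub>F n in sequentially. \<bar>\<sigma> (g n) (x n) - \<sigma> (g n) (y n)\<bar> \<le> B"
proof -
  note lb = locally_bounded_off_diagonal_lim[OF locally_bounded]
  obtain B1 B2 B3 B4 where B: "\<forall>\<^sub>F n in sequentially. \<bar>G (g n (z n), g n (x n))\<bar> \<le> B1"
    "\<forall>\<^sub>F n in sequentially. \<bar>G (g n (z n), g n (y n))\<bar> \<le> B2"
    "\<forall>\<^sub>F n in sequentially. \<bar>G (z n, x n)\<bar> \<le> B3"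
    "\<forall>\<^sub>F n in sequentially. \<bar>G (z n, y n)\<bar> \<le> B4"
    using lb[OF glim(1,2,4)] lb[OF glim(1,3,5)] lb[OF lim(1,2,4)] lb[OF lim(1,3,5)] by blast
  have "\<forall>\<^sub>F n in sequentially. z n \<noteq> x n" "\<forall>\<^sub>F n in sequentially. z n \<noteq> y n"
    using eventually_neq_of_lim lim by blast+
  with B have "\<forall>\<^sub>F n in sequentially. \<bar>\<sigma> (g n) (x n) - \<sigma> (g n) (y n)\<bar> \<le> B1 + B2 + B3 + B4 + 2 * \<kappa>"
    by eventually_elim (rule GPS_difference[OF g])
  then show ?thesis ..
qed

lemma far_values_close:
  assumes "\<epsilon> > 0"
  shows "\<exists>C>0. \<forall>g\<in>\<Gamma>. \<forall>x y. d (Inr x) (Inl (inv g)) > \<epsilon> \<longrightarrow> d (Inr y) (Inl (inv g)) > \<epsilon> \<longrightarrow>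
    \<bar>\<sigma> g x - \<sigma> g y\<bar> \<le> C"
proof -
  \<comment> \<open>The element and the two points are packed into one triple, so that a single
    sequence of triples carries the whole compactness argument.\<close>
  have "\<exists>C>0. \<forall>t. (case t of (g, x, y) \<Rightarrow> g \<in> \<Gamma> \<and> d (Inr x) (Inl (inv g)) > \<epsilon> \<and> d (Inr y) (Inl (inv g)) > \<epsilon>)
      \<longrightarrow> \<bar>case t of (g, x, y) \<Rightarrow> \<sigma> g x - \<sigma> g y\<bar> \<le> C"
  proof (rule uniform_bound_by_subsequences)
    fix s :: "nat \<Rightarrow> ('m \<Rightarrow> 'm) \<times> 'm \<times> 'm"
    assume s: "\<And>n. case s n of (g, x, y) \<Rightarrow> g \<in> \<Gamma> \<and> d (Inr x) (Inl (inv g)) > \<epsilon> \<and> d (Inr y) (Inl (inv g)) > \<epsilon>"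
    define g x y where "g = (\<lambda>n. fst (s n))" and "x = (\<lambda>n. fst (snd (s n)))" and "y = (\<lambda>n. snd (snd (s n)))"
    have s_eq: "s n = (g n, x n, y n)" for n by (simp add: g_def x_def y_def)
    have g: "g n \<in> \<Gamma>" and far: "d (Inr (x n)) (Inl (inv (g n))) > \<epsilon>" "d (Inr (y n)) (Inl (inv (g n))) > \<epsilon>" for n
      using s[of n] by (auto simp: s_eq)
    obtain r1 x0 where r1: "strict_mono r1" "(x \<circ> r1) \<longlonglongrightarrow> x0" by (rule convergent_subsequence_M)
    obtain r2 y0 where r2: "strict_mono r2" "((y \<circ> r1) \<circ> r2) \<longlonglongrightarrow> y0" by (rule convergent_subsequence_M)
    obtain r3 :: "nat \<Rightarrow> nat" where r3: "strict_mono r3"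
      "(\<exists>c. \<forall>n. g (r1 (r2 (r3 n))) = c) \<or> inj (\<lambda>n. g (r1 (r2 (r3 n))))"
      using constant_or_injective_subsequence[of "\<lambda>n. g (r1 (r2 n))"] by (auto simp: o_def)
    have "\<exists>r. strict_mono r \<and> (\<exists>B. \<forall>\<^sub>F n in sequentially.
        \<bar>\<sigma> (g (r1 (r2 (r n)))) (x (r1 (r2 (r n)))) - \<sigma> (g (r1 (r2 (r n)))) (y (r1 (r2 (r n))))\<bar> \<le> B)"
      using r3(2)
    proof
      assume "\<exists>c. \<forall>n. g (r1 (r2 (r3 n))) = c"
      then obtain c where c: "\<And>n. g (r1 (r2 (r3 n))) = c" by blast
      then have c_in: "c \<in> \<Gamma>" using g by metis
      \<comment> \<open>For a constant element any third point serves as \<open>z\<close>: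
        continuity gives the limits of the images and injectivity keeps them apart.\<close>
      obtain z where z: "z \<noteq> x0" "z \<noteq> y0" by (rule point_neq)
      have cont: "(\<lambda>n. c (p n)) \<longlonglongrightarrow> c q" if "p \<longlonglongrightarrow> q" for p q
        using isCont_tendsto_compose[OF continuous_in[OF c_in] that] .
      have lims: "(\<lambda>n. x (r1 (r2 (r3 n)))) \<longlonglongrightarrow> x0" "(\<lambda>n. y (r1 (r2 (r3 n)))) \<longlonglongrightarrow> y0"
        using LIMSEQ_subseq_LIMSEQ[OF r1(2) strict_mono_o[OF r2(1) r3(1)]]
          LIMSEQ_subseq_LIMSEQ[OF r2(2) r3(1)] by (simp_all add: o_def)
      have "c z \<noteq> c x0" "c z \<noteq> c y0" using z inv_cancel(1)[OF c_in] by metis+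
      with GPS_difference_lim[of "\<lambda>n. c" "\<lambda>n. z", OF c_in tendsto_const lims z cont[OF tendsto_const] cont[OF lims(1)] cont[OF lims(2)]]
      show ?thesis using r3(1) by (auto simp: c intro!: exI[of _ r3])
    next
      assume "inj (\<lambda>n. g (r1 (r2 (r3 n))))"
      then obtain r4 a b where r4: "strict_mono r4" "attracts (\<lambda>n. g (r1 (r2 (r3 (r4 n))))) a b"
        using injective_attracts[of "\<lambda>n. g (r1 (r2 (r3 n)))"] g by auto
      define r where "r = r3 \<circ> r4"
      have r: "strict_mono r" using r3(1) r4(1) by (simp add: r_def strict_mono_o)
      have att: "attracts (\<lambda>n. g (r1 (r2 (r n)))) a b" using r4(2) by (simp add: r_def)
      have lims: "(\<lambda>n. x (r1 (r2 (r n)))) \<longlonglongrightarrow> x0" "(\<lambda>n. y (r1 (r2 (r n)))) \<longlonglongrightarrow> y0"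
        using LIMSEQ_subseq_LIMSEQ[OF r1(2) strict_mono_o[OF r2(1) r]]
          LIMSEQ_subseq_LIMSEQ[OF r2(2) r] by (simp_all add: o_def)
      \<comment> \<open>The inverses tend to \<open>b\<close>, and both points stay
        \<open>\<epsilon>\<close>-far from the inverses.\<close>
      have xb: "x0 \<noteq> b" and yb: "y0 \<noteq> b"
        using far_lim[OF attracts_self(2)[OF att] lims(1) far(1) assms]
          far_lim[OF attracts_self(2)[OF att] lims(2) far(2) assms] by auto
      obtain w where w: "w \<noteq> a" using point_neq by metis
      have "\<exists>B. \<forall>\<^sub>F n in sequentially.
        \<bar>\<sigma> (g (r1 (r2 (r n)))) (x (r1 (r2 (r n)))) - \<sigma> (g (r1 (r2 (r n)))) (y (r1 (r2 (r n))))\<bar> \<le> B"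
      proof (rule GPS_difference_lim[where z = "\<lambda>n. inv (g (r1 (r2 (r n)))) w"])
        show "(\<lambda>n. inv (g (r1 (r2 (r n)))) w) \<longlonglongrightarrow> b"
          using attracts_inv_lim_M[OF att tendsto_const w] .
        show "(\<lambda>n. g (r1 (r2 (r n))) (inv (g (r1 (r2 (r n)))) w)) \<longlonglongrightarrow> w" by (simp add: g)
        show "(\<lambda>n. g (r1 (r2 (r n))) (x (r1 (r2 (r n))))) \<longlonglongrightarrow> a"
          using attracts_lim_M[OF att lims(1) xb] .
        show "(\<lambda>n. g (r1 (r2 (r n))) (y (r1 (r2 (r n))))) \<longlonglongrightarrow> a"
          using attracts_lim_M[OF att lims(2) yb] .
      qed (use g lims xb yb w in auto)
      then show ?thesis using r by blast
    qed
    then obtain r where "strict_mono r" "\<exists>B. \<forall>\<^sub>F n in sequentially.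
        \<bar>\<sigma> (g (r1 (r2 (r n)))) (x (r1 (r2 (r n)))) - \<sigma> (g (r1 (r2 (r n)))) (y (r1 (r2 (r n))))\<bar> \<le> B" by blast
    then show "\<exists>r :: nat \<Rightarrow> nat. strict_mono r \<and>
        (\<exists>B. \<forall>\<^sub>F n in sequentially. \<bar>case s (r n) of (g, x, y) \<Rightarrow> \<sigma> g x - \<sigma> g y\<bar> \<le> B)"
      using r1(1) r2(1) by (intro exI[of _ "r1 \<circ> (r2 \<circ> r)"]) (auto simp: s_eq intro!: strict_mono_o)
  qed
  then show ?thesis by (simp add: split_paired_all) blast
qed

text \<open>The value of the cocycle at one point far from the inverse serves as magnitude, because
  any two far values differ by a bounded amount.\<close>

lemma magnitude_exists: "\<exists>N. is_magnitude \<Gamma> d \<sigma> N"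
proof -
  obtain u v \<epsilon>0 where uv: "\<epsilon>0 > 0" "\<And>p. p \<in> \<Gamma> <+> UNIV \<Longrightarrow> d (Inr u) p > \<epsilon>0 \<or> d (Inr v) p > \<epsilon>0"
    using far_pair by (metis (no_types, lifting))
  define b where "b g = (if d (Inr u) (Inl (inv g)) > \<epsilon>0 then u else v)" for g :: "'m \<Rightarrow> 'm"
  have b: "d (Inr (b g)) (Inl (inv g)) > \<epsilon>0" if "g \<in> \<Gamma>" for g
    using uv(2)[of "Inl (inv g)"] inv_in[OF that] by (auto simp: b_def)
  have "is_magnitude \<Gamma> d \<sigma> (\<lambda>g. \<sigma> g (b g))"
    unfolding is_magnitude_def
  proof (intro allI impI)
    fix \<epsilon> :: real assume "\<epsilon> > 0"
    \<comment> \<open>The arbitrary point is only \<open>\<epsilon>\<close>-far and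
      \<open>b g\<close> only \<open>\<epsilon>0\<close>-far; the minimum admits both.\<close>
    then have "min \<epsilon> \<epsilon>0 > 0" using uv(1) by simp
    from far_values_close[OF this] obtain C where "C > 0" and
      C: "\<And>g x y. g \<in> \<Gamma> \<Longrightarrow> d (Inr x) (Inl (inv g)) > min \<epsilon> \<epsilon>0 \<Longrightarrow>
        d (Inr y) (Inl (inv g)) > min \<epsilon> \<epsilon>0 \<Longrightarrow> \<bar>\<sigma> g x - \<sigma> g y\<bar> \<le> C" by blast
    have "\<sigma> g (b g) - C \<le> \<sigma> g x \<and> \<sigma> g x \<le> \<sigma> g (b g) + C" if "g \<in> \<Gamma>" "d (Inr x) (Inl (inv g)) > \<epsilon>" for g x
      using C[OF that(1), of x "b g"] b[OF that(1)] that(2) by (simp add: min_less_iff_disj abs_le_iff algebra_simps)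
    then show "\<exists>C>0. \<forall>x. \<forall>\<gamma>\<in>\<Gamma>. d (Inr x) (Inl (inv \<gamma>)) > \<epsilon> \<longrightarrow>
        \<sigma> \<gamma> (b \<gamma>) - C \<le> \<sigma> \<gamma> x \<and> \<sigma> \<gamma> x \<le> \<sigma> \<gamma> (b \<gamma>) + C"
      using \<open>C > 0\<close> by blast
  qed
  then show ?thesis by blast
qed

section \<open>Magnitudes of inverses\<close>

lemma magnitude_bound:
  assumes "is_magnitude \<Gamma> d s N" "\<epsilon> > 0"
  shows "\<exists>C>0. \<forall>g\<in>\<Gamma>. \<forall>x. d (Inr x) (Inl (inv g)) > \<epsilon> \<longrightarrow> \<bar>N g - s g x\<bar> \<le> C"
proof -
  obtain C where "C > 0" "\<forall>x. \<forall>\<gamma>\<in>\<Gamma>. d (Inr x) (Inl (inv \<gamma>)) > \<epsilon> \<longrightarrow>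
        N \<gamma> - C \<le> s \<gamma> x \<and> s \<gamma> x \<le> N \<gamma> + C"
    using assms unfolding is_magnitude_def by blast
  then show ?thesis by (intro exI[of _ C]) (auto simp: abs_le_iff algebra_simps)
qed

text \<open>Evaluate \<open>N g\<close> at \<open>y\<close> and \<open>N' (inv g)\<close> at
  \<open>u\<close>. Since \<open>\<sigma>' (inv g) u\<close> is roughly
  \<open>- \<sigma>' g (inv g u)\<close>, the GPS identity at \<open>(inv g u, y)\<close> makes the
  difference of the two values roughly \<open>G (u, g y) - G (inv g u, y)\<close>.\<close>

lemma magnitude_inv:
  assumes N: "is_magnitude \<Gamma> d \<sigma> N" and N': "is_magnitude \<Gamma> d \<sigma>' N'"
  shows "\<exists>C>0. \<forall>g\<in>\<Gamma>. \<bar>N g - N' (inv g)\<bar> \<le> C"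
proof -
  interpret conj: coarse_GPS_system \<Gamma> d \<sigma>' \<sigma> "G \<circ> prod.swap" \<kappa> by (rule conjugate)
  have "\<exists>C>0. \<forall>g. g \<in> \<Gamma> \<longrightarrow> \<bar>N g - N' (inv g)\<bar> \<le> C"
  proof (rule uniform_bound_by_subsequences)
    fix g :: "nat \<Rightarrow> 'm \<Rightarrow> 'm" assume g: "\<And>n. g n \<in> \<Gamma>"
    obtain r :: "nat \<Rightarrow> nat" where r: "strict_mono r" "(\<exists>c. \<forall>n. g (r n) = c) \<or> inj (\<lambda>n. g (r n))"
      using constant_or_injective_subsequence[of g] by (auto simp: o_def)
    from r(2) show "\<exists>r :: nat \<Rightarrow> nat. strict_mono r \<and>
        (\<exists>B. \<forall>\<^sub>F n in sequentially. \<bar>N (g (r n)) - N' (inv (g (r n)))\<bar> \<le> B)"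
    proof
      assume "\<exists>c. \<forall>n. g (r n) = c"
      then obtain c where "\<And>n. g (r n) = c" by blast
      then show ?thesis using r(1) by (auto intro!: exI[of _ r] exI[of _ "\<bar>N c - N' (inv c)\<bar>"])
    next
      assume "inj (\<lambda>n. g (r n))"
      then obtain s a b where s: "strict_mono s" "attracts (\<lambda>n. g (r (s n))) a b"
        using injective_attracts[of "\<lambda>n. g (r n)"] g by auto
      define h where "h = (\<lambda>n. g (r (s n)))"
      have h: "h n \<in> \<Gamma>" for n using g by (simp add: h_def)
      have att: "attracts h a b" using s(2) by (simp add: h_def)
      \<comment> \<open>The pairs \<open>(u, h n y)\<close> and \<open>(inv (h n) u, y)\<close> tend
        to \<open>(u, a)\<close> and \<open>(b, y)\<close>, both off the diagonal by this
        choice.\<close>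
      obtain u y where u: "u \<noteq> a" and y: "y \<noteq> b" using point_neq by metis
      note x_lim = attracts_inv_lim_M[OF att tendsto_const u]
      note y_lim = attracts_lim_M[OF att tendsto_const y]
      \<comment> \<open>Eventually \<open>u\<close> is \<open>\<epsilon>\<close>-far from
        \<open>h n\<close>, which tends to \<open>a\<close>, and \<open>y\<close> from its inverse,
        which tends to \<open>b\<close>. So both magnitudes may be evaluated there.\<close>
      obtain \<epsilon> where eps: "\<epsilon> > 0" "\<epsilon> < d (Inr u) (Inr a)" "\<epsilon> < d (Inr y) (Inr b)"
        using d_pos[OF u] d_pos[OF y] by (metis field_lbound_gt_zero)
      obtain C1 where C1: "\<And>g x. g \<in> \<Gamma> \<Longrightarrow> d (Inr x) (Inl (inv g)) > \<epsilon> \<Longrightarrow> \<bar>N g - \<sigma> g x\<bar> \<le> C1"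
        using magnitude_bound[OF N eps(1)] by blast
      obtain C2 where C2: "\<And>g x. g \<in> \<Gamma> \<Longrightarrow> d (Inr x) (Inl (inv g)) > \<epsilon> \<Longrightarrow> \<bar>N' g - \<sigma>' g x\<bar> \<le> C2"
        using magnitude_bound[OF N' eps(1)] by blast
      obtain B1 where B1: "\<forall>\<^sub>F n in sequentially. \<bar>G (u, h n y)\<bar> \<le> B1"
        using locally_bounded_off_diagonal_lim[OF locally_bounded tendsto_const y_lim u] by blast
      obtain B2 where B2: "\<forall>\<^sub>F n in sequentially. \<bar>G (inv (h n) u, y)\<bar> \<le> B2"
        using locally_bounded_off_diagonal_lim[OF locally_bounded x_lim tendsto_const y[symmetric]] by blast
      have "\<forall>\<^sub>F n in sequentially. inv (h n) u \<noteq> y"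
        using eventually_neq_of_lim[OF x_lim tendsto_const y[symmetric]] .
      with B1 B2 eventually_far[OF attracts_self(1)[OF att] eps(2)]
        eventually_far[OF attracts_self(2)[OF att] eps(3)]
      have "\<forall>\<^sub>F n in sequentially. \<bar>N (h n) - N' (inv (h n))\<bar> \<le> C1 + C2 + B1 + B2 + 3 * \<kappa>"
      proof eventually_elim
        case (elim n)
        have "\<bar>N (h n) - \<sigma> (h n) y\<bar> \<le> C1" using C1 h elim by blast
        moreover have "\<bar>N' (inv (h n)) - \<sigma>' (inv (h n)) u\<bar> \<le> C2"
          using C2[OF inv_in[OF h], of u n] elim h by simp
        moreover have "\<bar>\<sigma>' (h n) (inv (h n) u) + \<sigma> (h n) y - (G (u, h n y) - G (inv (h n) u, y))\<bar> \<le> \<kappa>"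
          using GPS[OF h, of "inv (h n) u" y n] elim h by simp
        moreover have "\<bar>\<sigma>' (inv (h n)) u + \<sigma>' (h n) (inv (h n) u)\<bar> \<le> 2 * \<kappa>"
          using conj.cocycle_inv[OF h, of n "inv (h n) u"] h by simp
        ultimately show ?case using elim by linarith
      qed
      then show ?thesis using strict_mono_o[OF r(1) s(1)]
        by (intro exI[of _ "r \<circ> s"]) (auto simp: h_def)
    qed
  qed
  then show ?thesis by blast
qed


section \<open>Comparison of \<open>G\<close> with magnitudes\<close>

lemma G_magnitude_identity:
  assumes f: "f \<in> \<Gamma>" and h: "h \<in> \<Gamma>" and z: "z \<noteq> inv f (h x)"
    and "\<bar>N (inv f \<circ> h) - \<sigma> (inv f \<circ> h) x\<bar> \<le> C1" "\<bar>N h - \<sigma> h x\<bar> \<le> C1"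
    and "\<bar>N (inv f) - N' f\<bar> \<le> C2" "\<bar>N' f - \<sigma>' f z\<bar> \<le> C3"
  shows "\<bar>G (f z, h x) - (N (inv f) + N h - N (inv f \<circ> h))\<bar>
    \<le> \<bar>G (z, inv f (h x))\<bar> + 2 * C1 + C2 + C3 + 4 * \<kappa>"
proof -
  \<comment> \<open>Evaluating \<open>N h\<close> and \<open>N (inv f \<circ> h)\<close> at the same
    \<open>x\<close> cancels \<open>\<sigma> h x\<close>. The error \<open>4 * \<kappa>\<close> is
    one for this relation, two for inverting \<open>f\<close> and one for the GPS identity.\<close>
  have "\<bar>\<sigma> (inv f \<circ> h) x - (\<sigma> (inv f) (h x) + \<sigma> h x)\<bar> \<le> \<kappa>"
    using cocycle[OF inv_in[OF f] h] .
  moreover have "\<bar>\<sigma> (inv f) (h x) + \<sigma> f (inv f (h x))\<bar> \<le> 2 * \<kappa>"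
    using cocycle_inv[OF f, of "inv f (h x)"] f by simp
  moreover have "\<bar>\<sigma>' f z + \<sigma> f (inv f (h x)) - (G (f z, h x) - G (z, inv f (h x)))\<bar> \<le> \<kappa>"
    using GPS[OF f z] f by simp
  ultimately show ?thesis using assms(4-7) unfolding abs_le_iff by linarith
qed

lemma G_near_magnitudes:
  assumes N: "is_magnitude \<Gamma> d \<sigma> N" and G: "coarsely_continuous G"
  shows "\<exists>C>0. \<forall>a b. a \<noteq> b \<longrightarrow>
    (\<forall>\<^sub>F (f, h) in group_tending_to \<Gamma> d a \<times>\<^sub>F group_tending_to \<Gamma> d b.
      \<bar>G (a, b) - (N (inv f) + N h - N (inv f \<circ> h))\<bar> \<le> C)"
proof -
  interpret conj: coarse_GPS_system \<Gamma> d \<sigma>' \<sigma> "G \<circ> prod.swap" \<kappa> by (rule conjugate)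
  obtain N' where N': "is_magnitude \<Gamma> d \<sigma>' N'" using conj.magnitude_exists by blast
  obtain u v \<epsilon> where eps: "\<epsilon> > 0" and uv: "\<And>p. p \<in> \<Gamma> <+> UNIV \<Longrightarrow> d (Inr u) p > \<epsilon> \<or> d (Inr v) p > \<epsilon>"
    using far_pair by (metis (no_types, lifting))
  obtain C1 where C1: "C1 > 0" "\<And>g x. g \<in> \<Gamma> \<Longrightarrow> d (Inr x) (Inl (inv g)) > \<epsilon> \<Longrightarrow> \<bar>N g - \<sigma> g x\<bar> \<le> C1"
    using magnitude_bound[OF N eps] by blast
  obtain C3 where C3: "C3 > 0" "\<And>g x. g \<in> \<Gamma> \<Longrightarrow> d (Inr x) (Inl (inv g)) > \<epsilon> \<Longrightarrow> \<bar>N' g - \<sigma>' g x\<bar> \<le> C3"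
    using magnitude_bound[OF N' eps] by blast
  obtain C2 where C2: "C2 > 0" "\<And>g. g \<in> \<Gamma> \<Longrightarrow> \<bar>N g - N' (inv g)\<bar> \<le> C2"
    using magnitude_inv[OF N N'] by blast
  \<comment> \<open>This bound, like the constants before it, is fixed before \<open>a\<close> and
    \<open>b\<close> are given; that makes the final constant uniform.\<close>
  have "\<exists>B>0. \<forall>t. (case t of (z, y) \<Rightarrow> z \<in> {u, v} \<and> d (Inr z) (Inr y) > \<epsilon>) \<longrightarrow> \<bar>G t\<bar> \<le> B"
  proof (rule uniform_bound_by_subsequences)
    fix s :: "nat \<Rightarrow> 'm \<times> 'm"
    assume s: "\<And>n. case s n of (z, y) \<Rightarrow> z \<in> {u, v} \<and> d (Inr z) (Inr y) > \<epsilon>"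
    obtain r1 z0 where r1: "strict_mono r1" "((\<lambda>n. fst (s n)) \<circ> r1) \<longlonglongrightarrow> z0" by (rule convergent_subsequence_M)
    obtain r2 y0 where r2: "strict_mono r2" "(((\<lambda>n. snd (s n)) \<circ> r1) \<circ> r2) \<longlonglongrightarrow> y0" by (rule convergent_subsequence_M)
    have lims: "(\<lambda>n. fst (s (r1 (r2 n)))) \<longlonglongrightarrow> z0" "(\<lambda>n. snd (s (r1 (r2 n)))) \<longlonglongrightarrow> y0"
      using LIMSEQ_subseq_LIMSEQ[OF r1(2) r2(1)] r2(2) by (simp_all add: o_def)
    have "z0 \<noteq> y0"
      using far_lim[OF limitin_Inr[THEN iffD2, OF lims(2)] lims(1) _ eps] s by (auto simp: case_prod_unfold)
    from locally_bounded_off_diagonal_lim[OF locally_bounded lims this]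
    show "\<exists>r :: nat \<Rightarrow> nat. strict_mono r \<and> (\<exists>B. \<forall>\<^sub>F n in sequentially. \<bar>G (s (r n))\<bar> \<le> B)"
      using strict_mono_o[OF r1(1) r2(1)] by (intro exI[of _ "r1 \<circ> r2"]) simp
  qed
  then obtain B where B: "B > 0" "\<And>z y. z \<in> {u, v} \<Longrightarrow> d (Inr z) (Inr y) > \<epsilon> \<Longrightarrow> \<bar>G (z, y)\<bar> \<le> B"
    by auto
  obtain k where k: "k \<ge> 0" "\<And>z. z \<in> off_diagonal UNIV \<Longrightarrow>
      Limsup (at z within off_diagonal UNIV) (\<lambda>w. ereal \<bar>G z - G w\<bar>) \<le> ereal k"
    using G unfolding coarsely_continuous_def by blast
  \<comment> \<open>The summand \<open>k + 1\<close> is the cost of replacing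
    \<open>G (a, b)\<close> by nearby values, and the rest comes from
    \<open>G_magnitude_identity\<close>. The absolute value of \<open>\<kappa>\<close> makes
    positivity immediate.\<close>
  define C where "C = k + 1 + (B + 2 * C1 + C2 + C3 + 4 * \<bar>\<kappa>\<bar>)"
  have "\<exists>n. \<bar>G (a, b) - (N (inv (f n)) + N (h n) - N (inv (f n) \<circ> h n))\<bar> \<le> C"
    if ab: "a \<noteq> b" and f: "\<And>n. f n \<in> \<Gamma>" and h: "\<And>n. h n \<in> \<Gamma>"
      and flim: "limitin T (\<lambda>n. Inl (f n)) (Inr a) sequentially"
      and hlim: "limitin T (\<lambda>n. Inl (h n)) (Inr b) sequentially" for a b f h
  proof -
    obtain r1 a' where r1: "strict_mono r1" "attracts (\<lambda>n. f (r1 n)) a a'"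
      using tending_attracts[OF f flim] by blast
    obtain r2 b' where r2: "strict_mono r2" "attracts (\<lambda>n. h (r1 (r2 n))) b b'"
      using tending_attracts[OF h limitin_subseq[OF r1(1) hlim]] by blast
    define f' h' where "f' = (\<lambda>n. f (r1 (r2 n)))" and "h' = (\<lambda>n. h (r1 (r2 n)))"
    have f': "f' n \<in> \<Gamma>" and h': "h' n \<in> \<Gamma>" for n using f h by (auto simp: f'_def h'_def)
    have fa: "attracts f' a a'" using attracts_subseq[OF r1(2) r2(1)] by (simp add: f'_def)
    have ha: "attracts h' b b'" using r2(2) by (simp add: h'_def)
    \<comment> \<open>The inverses of \<open>h'\<close> tend to \<open>b'\<close> and those of
      \<open>f'\<close> to \<open>a'\<close>, so being far from these two limits is eventually being
      far from the inverses.\<close>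
    obtain x where x: "d (Inr x) (Inr b') > \<epsilon>" using uv[of "Inr b'"] by auto
    obtain z where z: "z \<in> {u, v}" "d (Inr z) (Inr a') > \<epsilon>" using uv[of "Inr a'"] by auto
    have x_neq: "x \<noteq> b'" and z_neq: "z \<noteq> a'" using x z(2) eps by (auto simp: mdist_zero)
    have hx: "(\<lambda>n. h' n x) \<longlonglongrightarrow> b" by (rule attracts_lim_M[OF ha tendsto_const x_neq])
    have fz: "(\<lambda>n. f' n z) \<longlonglongrightarrow> a" by (rule attracts_lim_M[OF fa tendsto_const z_neq])
    have y: "(\<lambda>n. inv (f' n) (h' n x)) \<longlonglongrightarrow> a'"
      by (rule attracts_inv_lim_M[OF fa hx ab[symmetric]])
    \<comment> \<open>The inverse of \<open>inv (f' n) \<circ> h' n\<close> is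
      \<open>inv (h' n) \<circ> f' n\<close>. As \<open>f' n\<close> tends to \<open>a\<close>,
      which is not \<open>b\<close>, this product tends to \<open>b'\<close> as well, so the same
      \<open>x\<close> is far from it too.\<close>
    have "limitin T (\<lambda>n. union_action (inv (h' n)) (Inl (f' n))) (Inr b') sequentially"
      by (rule attracts_inv_lim[OF ha attracts_self(1)[OF fa]]) (use ab f' in auto)
    moreover have "inv (inv (f' n) \<circ> h' n) = inv (h' n) \<circ> f' n" for n
      using o_inv_distrib[OF bij_in[OF inv_in[OF f']] bij_in[OF h']] f' by simp
    ultimately have ginv: "limitin T (\<lambda>n. Inl (inv (inv (f' n) \<circ> h' n))) (Inr b') sequentially"
      by simp
    have "\<forall>\<^sub>F n in sequentially. \<bar>G (a, b) - G (f' n z, h' n x)\<bar> \<le> k + 1"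
      by (rule coarsely_continuous_lim[OF k(2,1) fz hx ab])
    moreover have "\<forall>\<^sub>F n in sequentially. d (Inr z) (Inr (inv (f' n) (h' n x))) > \<epsilon>"
      using eventually_far[OF limitin_Inr[THEN iffD2, OF y] z(2)] .
    moreover note eventually_far[OF ginv x] eventually_far[OF attracts_self(2)[OF ha] x]
      eventually_far[OF attracts_self(2)[OF fa] z(2)]
    ultimately have "\<forall>\<^sub>F n in sequentially.
      \<bar>G (a, b) - (N (inv (f' n)) + N (h' n) - N (inv (f' n) \<circ> h' n))\<bar> \<le> C"
    proof eventually_elim
      case (elim n)
      have "z \<noteq> inv (f' n) (h' n x)" using elim(2) eps by (auto simp: mdist_zero)
      have "\<bar>G (f' n z, h' n x) - (N (inv (f' n)) + N (h' n) - N (inv (f' n) \<circ> h' n))\<bar>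
        \<le> \<bar>G (z, inv (f' n) (h' n x))\<bar> + 2 * C1 + C2 + C3 + 4 * \<kappa>"
      proof (rule G_magnitude_identity[OF f' h' \<open>z \<noteq> inv (f' n) (h' n x)\<close>])
        show "\<bar>N (inv (f' n) \<circ> h' n) - \<sigma> (inv (f' n) \<circ> h' n) x\<bar> \<le> C1"
          using C1(2)[OF comp_in[OF inv_in[OF f'] h']] elim(3) .
        show "\<bar>N (h' n) - \<sigma> (h' n) x\<bar> \<le> C1" using C1(2)[OF h'] elim(4) .
        show "\<bar>N (inv (f' n)) - N' (f' n)\<bar> \<le> C2" using C2(2)[OF inv_in[OF f'], of n] f' by simp
        show "\<bar>N' (f' n) - \<sigma>' (f' n) z\<bar> \<le> C3" using C3(2)[OF f'] elim(5) .
      qed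
      moreover have "\<bar>G (z, inv (f' n) (h' n x))\<bar> \<le> B" using B(2) z(1) elim(2) by blast
      ultimately show ?case using elim(1) unfolding C_def by linarith
    qed
    then show ?thesis by (auto simp: f'_def h'_def eventually_sequentially)
  qed
  then have "\<forall>\<^sub>F (f, h) in group_tending_to \<Gamma> d a \<times>\<^sub>F group_tending_to \<Gamma> d b.
      \<bar>G (a, b) - (N (inv f) + N h - N (inv f \<circ> h))\<bar> \<le> C" if "a \<noteq> b" for a b
    by (rule eventually_pair_tending_to) (use that in auto)
  moreover have "C > 0" using k(1) B(1) C1(1) C2(1) C3(1) by (simp add: C_def)
  ultimately show ?thesis by blast
qed

end

section \<open>From the hypotheses to the three claims\<close>

lemma non_elementary_three_points:
  assumes "non_elementary (\<Gamma> :: ('m::metric_space \<Rightarrow> 'm) set)"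
  shows "\<exists>u v w :: 'm. u \<noteq> v \<and> u \<noteq> w \<and> v \<noteq> w"
proof -
  obtain A where "A \<subseteq> limit_set \<Gamma>" "card A = 3"
    using assms infinite_arbitrarily_large obtain_subset_with_card_n
    unfolding non_elementary_def by metis
  then show ?thesis by (auto simp: card_3_iff)
qed

theorem proposition3p4:
  fixes \<Gamma> :: "('m::metric_space \<Rightarrow> 'm) set"
    and d :: "'m union_metric"
    and \<sigma> \<sigma>' :: "('m \<Rightarrow> 'm) \<Rightarrow> 'm \<Rightarrow> real"
    and G :: "'m \<times> 'm \<Rightarrow> real"
  assumes "compact (UNIV :: 'm set)"
    and "convergence_group \<Gamma>"
    and "non_elementary \<Gamma>"
    and "compatible_metric \<Gamma> d"
    and "coarse_GPS \<Gamma> d \<sigma> \<sigma>' G"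
  shows "(expanding \<Gamma> d \<sigma> \<and> expanding \<Gamma> d \<sigma>') \<and>
    (\<forall>N N'. is_magnitude \<Gamma> d \<sigma> N \<and> is_magnitude \<Gamma> d \<sigma>' N' \<longrightarrow>
       (\<exists>C>0. \<forall>\<gamma>\<in>\<Gamma>. N' (inv \<gamma>) - C \<le> N \<gamma> \<and> N \<gamma> \<le> N' (inv \<gamma>) + C)) \<and>
    (coarsely_continuous G \<longrightarrow>
       (\<forall>N. is_magnitude \<Gamma> d \<sigma> N \<longrightarrow>
          (\<exists>C'>0. \<forall>(a, b)\<in>off_diagonal (limit_set \<Gamma>).
             Limsup (group_tending_to \<Gamma> d a \<times>\<^sub>F group_tending_to \<Gamma> d b)
               (\<lambda>(\<alpha>, \<beta>). ereal \<bar>G (a, b) - (N (inv \<alpha>) + N \<beta> - N (inv \<alpha> \<circ> \<beta>))\<bar>)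
             \<le> ereal C')))"
proof -
  obtain \<kappa> where "coarse_cocycle \<Gamma> \<kappa> \<sigma>" "coarse_cocycle \<Gamma> \<kappa> \<sigma>'"
    and proper: "proper_cocycle \<Gamma> d \<sigma>" "proper_cocycle \<Gamma> d \<sigma>'"
    and "locally_bounded_off_diagonal G"
    and "\<forall>\<gamma>\<in>\<Gamma>. \<forall>x y. x \<noteq> y \<longrightarrow> \<bar>(\<sigma>' \<gamma> x + \<sigma> \<gamma> y) - (G (\<gamma> x, \<gamma> y) - G (x, y))\<bar> \<le> \<kappa>"
    using assms(5) unfolding coarse_GPS_def by (elim exE conjE) (rule that)
  moreover have "Metric_space (\<Gamma> <+> UNIV) d"
    and "compactifying_topology \<Gamma> (Metric_space.mtopology (\<Gamma> <+> UNIV) d)"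
    using assms(4) unfolding compatible_metric_def union_topology_def by auto
  ultimately interpret coarse_GPS_system \<Gamma> d \<sigma> \<sigma>' G \<kappa>
    using assms(1,2) non_elementary_three_points[OF assms(3)]
    by (intro coarse_GPS_system.intro compactified_group.intro compactified_group_axioms.intro
        coarse_GPS_system_axioms.intro) (auto simp: coarse_cocycle_def)
  \<comment> \<open>The swapped system provides the magnitude of \<open>\<sigma>'\<close>.\<close>
  interpret conj: coarse_GPS_system \<Gamma> d \<sigma>' \<sigma> "G \<circ> prod.swap" \<kappa> by (rule conjugate)
  have "expanding \<Gamma> d \<sigma>" "expanding \<Gamma> d \<sigma>'"
    unfolding expanding_def using proper magnitude_exists conj.magnitude_exists by blast+
  moreover have "\<exists>C>0. \<forall>\<gamma>\<in>\<Gamma>. N' (inv \<gamma>) - C \<le> N \<gamma> \<and> N \<gamma> \<le> N' (inv \<gamma>) + C"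
    if N: "is_magnitude \<Gamma> d \<sigma> N" "is_magnitude \<Gamma> d \<sigma>' N'" for N N'
  proof -
    obtain C where "C > 0" "\<And>g. g \<in> \<Gamma> \<Longrightarrow> \<bar>N g - N' (inv g)\<bar> \<le> C"
      using magnitude_inv[OF N] by blast
    then show ?thesis by (intro exI[of _ C]) (auto simp: abs_le_iff algebra_simps)
  qed
  moreover have "\<exists>C'>0. \<forall>(a, b)\<in>off_diagonal (limit_set \<Gamma>).
      Limsup (group_tending_to \<Gamma> d a \<times>\<^sub>F group_tending_to \<Gamma> d b)
        (\<lambda>(\<alpha>, \<beta>). ereal \<bar>G (a, b) - (N (inv \<alpha>) + N \<beta> - N (inv \<alpha> \<circ> \<beta>))\<bar>) \<le> ereal C'"
    if cont: "coarsely_continuous G" and N: "is_magnitude \<Gamma> d \<sigma> N" for N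
  proof -
    obtain C where "C > 0" and C: "\<And>a b. a \<noteq> b \<Longrightarrow>
        \<forall>\<^sub>F (\<alpha>, \<beta>) in group_tending_to \<Gamma> d a \<times>\<^sub>F group_tending_to \<Gamma> d b.
          \<bar>G (a, b) - (N (inv \<alpha>) + N \<beta> - N (inv \<alpha> \<circ> \<beta>))\<bar> \<le> C"
      using G_near_magnitudes[OF N cont] by blast
    have "Limsup (group_tending_to \<Gamma> d a \<times>\<^sub>F group_tending_to \<Gamma> d b)
        (\<lambda>(\<alpha>, \<beta>). ereal \<bar>G (a, b) - (N (inv \<alpha>) + N \<beta> - N (inv \<alpha> \<circ> \<beta>))\<bar>) \<le> ereal C"
      if "a \<noteq> b" for a b
      using C[OF that] by (intro Limsup_bounded) (simp add: case_prod_unfold)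
    then show ?thesis using \<open>C > 0\<close> by (auto simp: off_diagonal_def intro!: exI[of _ C])
  qed
  ultimately show ?thesis by blast
qed

end
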